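(* Let $G=(\tilde S,\tilde C,\tilde\Omega)\in\mathcal{L}^{\mathrm{Bog.}}(n_1+n_2,m)$, with $\tilde S=\Delta(S_-,S_+)$, $\tilde C=\Delta(C_-,C_+)$, partitioned as $$S_\mp=\begin{bmatrix} S^\mp_{11} & S^\mp_{12}\\ S^\mp_{21} & S^\mp_{22}\end{bmatrix},\quad C_\mp=\begin{bmatrix} C_1^\mp \\ C_2^\mp \end{bmatrix},\qquad S^\mp_{jk}\in\mathbb{C}^{n_j\times n_k},\ C_j^\mp\in\mathbb{C}^{n_j\times m},$$ and put $\hat S_{jk}=\Delta(S^-_{jk},S^+_{jk})$, $\tilde C_j=\Delta(C_j^-,C_j^+)$, $\tilde A=-\frac12\tilde C^\flat\tilde C-i\tilde\Omega$. Assume that $I-\hat S_{22}$ is invertible. Then the zero-delay feedback network $N_0$, obtained from $G$ by feeding the second group of $n_2$ output channels directly back into the second group of $n_2$ input channels, is a system in $\mathcal{L}^{\mathrm{Bog.}}(n_1,m)$ with parameters $N_0=(\tilde S_0,\tilde C_0,\tilde\Omega_0)$, where $$\tilde S_0=\hat S_{11}+\hat S_{12}(I-\hat S_{22})^{-1}\hat S_{21},\qquad \tilde C_0=\tilde C_1+\hat S_{12}(I-\hat S_{22})^{-1}\tilde C_2,$$ $$\tilde\Omega_0=\tilde\Omega+\mathrm{Im}_\flat\sum_{j=1,2}\tilde C_j^\flat\hat S_{j2}(I-\hat S_{22})^{-1}\tilde C_2 .$$ That is, $\tilde S_0\in\mathrm{Sp}(\mathbb{C}^{n_1})$, $(\tilde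 S_0,\tilde C_0,\tilde\Omega_0)\in\mathcal{L}^{\mathrm{Bog.}}(n_1,m)$, and eliminating $\breve b_2,\breve b_{\mathrm{out},2}$ from the equations of $G$ by the constraint $\breve b_2=\breve b_{\mathrm{out},2}$ gives $$\dot{\breve a}=\tilde A_0\breve a-\tilde C_0^\flat\tilde S_0\,\breve b_1,\qquad \breve b_{\mathrm{out},1}=\tilde C_0\breve a+\tilde S_0\breve b_1,$$ where $$\tilde A_0=\tilde A-\sum_{j=1,2}\tilde C_j^\flat\hat S_{j2}(I-\hat S_{22})^{-1}\tilde C_2=-\tfrac12\tilde C_0^\flat\tilde C_0-i\tilde\Omega_0 .$$
   Context: For a complex matrix $X$, $X^\#$ is the entrywise complex conjugate and $X^\dagger$ the conjugate transpose. For $E_-,E_+\in\mathbb{C}^{r\times k}$, the doubled-up matrix is $$\Delta(E_-,E_+)=\begin{bmatrix} E_- & E_+ \\ E_+^\# & E_-^\# \end{bmatrix}\in\mathbb{C}^{2r\times2k}.$$ Let $J_n=\begin{bmatrix} I_n & 0 \\ 0 & -I_n \end{bmatrix}$; for a $2n\times2m$ matrix $X$ put $X^\flat=J_mX^\dagger J_n$, and for a square matrix $X$ of even size put $\mathrm{Im}_\flat X=\frac1{2i}(X-X^\flat)$. $\mathrm{Sp}(\mathbb{C}^n)$ is the group of $2n\times2n$ matrices $\tilde S$ of doubled-up form $\Delta(S_-,S_+)$ with $\tilde S^\flat\tilde S=\tilde S\tilde S^\flat=I$. $\mathcal{L}^{\mathrm{Bog.}}(n,m)$ is the class of linear quantum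 systems with $m$ oscillator modes and $n$ field channels; a system is given by a triple $(\tilde S,\tilde C,\tilde\Omega)$ with $\tilde S\in\mathrm{Sp}(\mathbb{C}^n)$, $\tilde C=\Delta(C_-,C_+)$ for some $C_\pm\in\mathbb{C}^{n\times m}$, and $\tilde\Omega\in\mathbb{C}^{2m\times2m}$ such that $-i\tilde\Omega$ is of doubled-up form and $\tilde\Omega^\flat=\tilde\Omega$. It is described by the linear equations $$\dot{\breve a}=\tilde A\breve a-\tilde C^\flat\tilde S\,\breve b,\qquad \breve b_{\mathrm{out}}=\tilde C\breve a+\tilde S\breve b,\qquad \tilde A=-\tfrac12\tilde C^\flat\tilde C-i\tilde\Omega,$$ where $\breve x=\begin{bmatrix} x \\ x^\# \end{bmatrix}$ denotes the doubled-up vector of mode operators $a$ (length $m$), input fields $b$ or output fields $b_{\mathrm{out}}$ (length $n$); the relations are used here purely algebraically. When $n=n_1+n_2$ and the channels are split as $b=(b_1,b_2)$, $b_{\mathrm{out}}=(b_{\mathrm{out},1},b_{\mathrm{out},2})$ with lengths $n_1,n_2$, these equations read, after reordering components, $$\dot{\breve a}=\tilde A\breve a-\sum_{j,k=1,2}\tilde C_j^\flat\hat S_{jk}\breve b_k,\qquad \breve b_{\mathrm{out},j}=\tilde C_j\breve a+\sum_{k=1,2}\hat S_{jk}\breve b_k .$$ *)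

theory Defs
  imports "Jordan_Normal_Form.Schur_Decomposition" "Jordan_Normal_Form.Gauss_Jordan_Elimination"
begin

section \<open>Doubled-up matrices\<close>

definition doubled :: "complex mat \<Rightarrow> complex mat \<Rightarrow> complex mat" where
  "doubled Em Ep = four_block_mat Em Ep (map_mat cnj Ep) (map_mat cnj Em)"

definition is_doubled :: "nat \<Rightarrow> nat \<Rightarrow> complex mat \<Rightarrow> bool" where
  "is_doubled r k X \<longleftrightarrow>
     (\<exists>Em \<in> carrier_mat r k. \<exists>Ep \<in> carrier_mat r k. X = doubled Em Ep)"

definition Jmat :: "nat \<Rightarrow> complex mat" where
  "Jmat n = four_block_mat (1\<^sub>m n) (0\<^sub>m n n) (0\<^sub>m n n) (- 1\<^sub>m n)"

text \<open>The sizes in \<open>flat\<close> are read off from the argument: for a matrix with \<open>2n\<close> rows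
  and \<open>2m\<close> columns it is \<open>Jmat m * mat_adjoint X * Jmat n\<close>. It is only meant for
  matrices with an even number of rows and of columns.\<close>

definition flat :: "complex mat \<Rightarrow> complex mat" where
  "flat X = Jmat (dim_col X div 2) * mat_adjoint X * Jmat (dim_row X div 2)"

definition Im_flat :: "complex mat \<Rightarrow> complex mat" where
  "Im_flat X = (1 / (2 * \<i>)) \<cdot>\<^sub>m (X - flat X)"

definition symp_group :: "nat \<Rightarrow> complex mat set" where
  "symp_group n = {S. is_doubled n n S \<and> flat S * S = 1\<^sub>m (2 * n) \<and> S * flat S = 1\<^sub>m (2 * n)}"

text \<open>Only meaningful for invertible matrices.\<close>

definition mat_inv :: "complex mat \<Rightarrow> complex mat" where
  "mat_inv X = the (mat_inverse X)"

section \<open>Linear quantum systems\<close>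

type_synonym lin_system = "complex mat \<times> complex mat \<times> complex mat"

text \<open>\<open>Bog n m\<close>: systems with \<open>n\<close> field channels and \<open>m\<close> oscillator modes.\<close>

definition Bog :: "nat \<Rightarrow> nat \<Rightarrow> lin_system set" where
  "Bog n m = {(S, C, Om).
     S \<in> symp_group n \<and> is_doubled n m C \<and>
     Om \<in> carrier_mat (2 * m) (2 * m) \<and> is_doubled m m ((- \<i>) \<cdot>\<^sub>m Om) \<and> flat Om = Om}"

fun drift :: "lin_system \<Rightarrow> complex mat" where
  "drift (S, C, Om) = (- 1 / 2) \<cdot>\<^sub>m (flat C * C) - \<i> \<cdot>\<^sub>m Om"

text \<open>Mode operators and fields enter the equations only through complex linear combinations
  and the adjoint \<open>#\<close>. They are therefore taken from an arbitrary complex vector space with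
  a conjugate-linear involution; \<open>\<complex>\<close> with complex conjugation is a special case.\<close>

locale star_vector_space = vector_space scale
  for scale :: "complex \<Rightarrow> 'v::ab_group_add \<Rightarrow> 'v" +
  fixes star :: "'v \<Rightarrow> 'v"
  assumes star_add: "star (x + y) = star x + star y"
    and star_scale: "star (scale c x) = scale (cnj c) (star x)"
    and star_star: "star (star x) = x"

definition breve :: "('v \<Rightarrow> 'v) \<Rightarrow> 'v vec \<Rightarrow> 'v vec" where
  "breve star x = x @\<^sub>v map_vec star x"

definition mat_act :: "(complex \<Rightarrow> 'v::ab_group_add \<Rightarrow> 'v) \<Rightarrow> complex mat \<Rightarrow> 'v vec \<Rightarrow> 'v vec" where
  "mat_act scale M x = vec (dim_row M) (\<lambda>i. \<Sum>j<dim_vec x. scale (M $$ (i, j)) (x $ j))"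

text \<open>The argument \<open>adot\<close> stands for the time derivative of the vector \<open>a\<close> of modes. As the
  equations are used purely algebraically, it is an independent vector.\<close>

fun system_eqs ::
  "(complex \<Rightarrow> 'v::ab_group_add \<Rightarrow> 'v) \<Rightarrow> ('v \<Rightarrow> 'v) \<Rightarrow> lin_system \<Rightarrow>
    'v vec \<Rightarrow> 'v vec \<Rightarrow> 'v vec \<Rightarrow> 'v vec \<Rightarrow> bool" where
  "system_eqs scale star (S, C, Om) adot a b bout \<longleftrightarrow>
     breve star adot = mat_act scale (drift (S, C, Om)) (breve star a)
                         - mat_act scale (flat C * S) (breve star b) \<and>
     breve star bout = mat_act scale C (breve star a) + mat_act scale S (breve star b)"

text \<open>The equations of a system whose last \<open>n2\<close> output channels are fed back into its last
  \<open>n2\<close> input channels, with the internal signals \<open>b2\<close> and \<open>bout2\<close> eliminated.\<close>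

definition feedback_eqs ::
  "(complex \<Rightarrow> 'v::ab_group_add \<Rightarrow> 'v) \<Rightarrow> ('v \<Rightarrow> 'v) \<Rightarrow> nat \<Rightarrow> lin_system \<Rightarrow>
    'v vec \<Rightarrow> 'v vec \<Rightarrow> 'v vec \<Rightarrow> 'v vec \<Rightarrow> bool" where
  "feedback_eqs scale star n2 G adot a b1 bout1 \<longleftrightarrow>
     (\<exists>b2 \<in> carrier_vec n2. \<exists>bout2 \<in> carrier_vec n2.
        breve star b2 = breve star bout2 \<and>
        system_eqs scale star G adot a (b1 @\<^sub>v b2) (bout1 @\<^sub>v bout2))"

end

theory Submission
  imports Defs
begin

text \<open>
  Put \<open>T = R S21\<close>, \<open>D = R C2\<close>, and stack \<open>W = (I; T)\<close>, \<open>V = (0; D)\<close> in the order of the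
  doubled-up channel vector. The feedback constraint is solved by \<open>b2 = T b1 + D a\<close>, so that the
  complete input is \<open>W b1 + V a\<close>, and \<open>R\<close> being the resolvent of \<open>S22\<close> means
  \<open>S W = (S0; T)\<close> and \<open>S V + C = (C0; D)\<close>. As \<open>S\<close> preserves the indefinite form
  \<open>(P, Q) \<mapsto> flat P * Q\<close>, taking the Gram matrices of these two stacked matrices and cancelling
  the second components gives \<open>flat S0 * S0 = 1\<close>, \<open>flat C0 * S0 = flat C * S * W\<close> and
  \<open>flat C0 * C0 = flat X + X + flat C * C\<close> with \<open>X = flat C * S * V\<close>. These are the symplecticity
  of \<open>S0\<close>, the input matrix, and the splitting of the drift into its two parts.
  Doubled-up form is preserved because it means being fixed by a multiplicative conjugation.
\<close>

text \<open>The dimension \<open>2 * (n1 + n2)\<close> must keep this form for the carrier rules to match.\<close>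

declare distrib_left_numeral [simp del]

section \<open>Signs, adjoints and the involution \<open>flat\<close>\<close>

text \<open>The diagonal of \<open>Jmat n\<close> as a sign function, so that \<open>flat\<close>
  gets an entrywise formula and later proofs need no products with \<open>Jmat\<close>.\<close>

definition sig :: "nat \<Rightarrow> nat \<Rightarrow> complex" where
  "sig n i = (if i < n then 1 else -1)"

lemma sig_square [simp]: "sig n i * sig n i = 1"
  by (simp add: sig_def)

lemma cnj_sig [simp]: "cnj (sig n i) = sig n i"
  by (simp add: sig_def)

lemma Jmat_eq: "Jmat n = mat (2 * n) (2 * n) (\<lambda>(i, j). if i = j then sig n i else 0)"
  by (rule eq_matI) (auto simp: Jmat_def sig_def)

lemma Jmat_mult:
  assumes "Y \<in> carrier_mat (2 * m) k"
  shows "Jmat m * Y = mat (2 * m) k (\<lambda>(i, j). sig m i * Y $$ (i, j))"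
proof (rule eq_matI)
  fix i j assume "i < dim_row (mat (2 * m) k (\<lambda>(i, j). sig m i * Y $$ (i, j)))"
    "j < dim_col (mat (2 * m) k (\<lambda>(i, j). sig m i * Y $$ (i, j)))"
  then have ij: "i < 2 * m" "j < k" by auto
  show "(Jmat m * Y) $$ (i, j) = mat (2 * m) k (\<lambda>(i, j). sig m i * Y $$ (i, j)) $$ (i, j)"
    using ij assms
    by (auto simp: Jmat_eq scalar_prod_def atLeast0LessThan if_distrib[of "\<lambda>x. x * y" for y]
        if_distrib[of "(*) y" for y] cong: if_cong)
qed (use assms in \<open>auto simp: Jmat_eq\<close>)

lemma mult_Jmat:
  assumes "Y \<in> carrier_mat k (2 * n)"
  shows "Y * Jmat n = mat k (2 * n) (\<lambda>(i, j). Y $$ (i, j) * sig n j)"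
proof (rule eq_matI)
  fix i j assume "i < dim_row (mat k (2 * n) (\<lambda>(i, j). Y $$ (i, j) * sig n j))"
    "j < dim_col (mat k (2 * n) (\<lambda>(i, j). Y $$ (i, j) * sig n j))"
  then have ij: "i < k" "j < 2 * n" by auto
  show "(Y * Jmat n) $$ (i, j) = mat k (2 * n) (\<lambda>(i, j). Y $$ (i, j) * sig n j) $$ (i, j)"
    using ij assms
    by (auto simp: Jmat_eq scalar_prod_def atLeast0LessThan if_distrib[of "\<lambda>x. x * y" for y]
        if_distrib[of "(*) y" for y] cong: if_cong)
qed (use assms in \<open>auto simp: Jmat_eq\<close>)

text \<open>Multiplying by the two signature matrices only attaches one sign to each row and one to
  each column of the adjoint. The algebraic laws of \<open>flat\<close> below are read off from this
  formula.\<close>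

lemma flat_eq:
  assumes "X \<in> carrier_mat (2 * n) (2 * m)"
  shows "flat X = mat (2 * m) (2 * n) (\<lambda>(i, j). sig m i * cnj (X $$ (j, i)) * sig n j)"
proof -
  have adj: "mat_adjoint X = mat (2 * m) (2 * n) (\<lambda>(i, j). cnj (X $$ (j, i)))"
    using assms by (intro eq_matI) (auto simp: mat_adjoint_def mat_of_rows_def)
  show ?thesis
    using assms unfolding flat_def adj
    by (subst Jmat_mult[where k = "2 * n"], simp, simp, subst mult_Jmat[where k = "2 * m"])
       (auto intro!: eq_matI)
qed

lemma flat_carrier [simp, intro]:
  "X \<in> carrier_mat (2 * n) (2 * m) \<Longrightarrow> flat X \<in> carrier_mat (2 * m) (2 * n)"
  by (simp add: flat_eq)

lemma flat_index:
  assumes "X \<in> carrier_mat (2 * n) (2 * m)" "i < 2 * m" "j < 2 * n"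
  shows "flat X $$ (i, j) = sig m i * cnj (X $$ (j, i)) * sig n j"
  using assms by (simp add: flat_eq)

lemma flat_flat: "X \<in> carrier_mat (2 * n) (2 * m) \<Longrightarrow> flat (flat X) = X"
  by (rule eq_matI) (auto simp: flat_eq[of "flat X" m n] flat_index[of X n m] sig_def)

lemma flat_add:
  assumes "X \<in> carrier_mat (2 * n) (2 * m)" "Y \<in> carrier_mat (2 * n) (2 * m)"
  shows "flat (X + Y) = flat X + flat Y"
  using assms
  by (intro eq_matI) (auto simp: flat_eq[of _ n m] algebra_simps)

lemma flat_minus:
  assumes "X \<in> carrier_mat (2 * n) (2 * m)" "Y \<in> carrier_mat (2 * n) (2 * m)"
  shows "flat (X - Y) = flat X - flat Y"
  using assms minus_carrier_mat[of Y "2 * n" "2 * m" X]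
  by (intro eq_matI) (auto simp: flat_eq[of _ n m] algebra_simps)

lemma flat_smult:
  assumes "X \<in> carrier_mat (2 * n) (2 * m)"
  shows "flat (c \<cdot>\<^sub>m X) = cnj c \<cdot>\<^sub>m flat X"
  using assms
  by (intro eq_matI) (auto simp: flat_eq[of _ n m] algebra_simps)

text \<open>The summation index carries one sign from each factor, and the two signs multiply to
  one.\<close>

lemma flat_mult:
  assumes "X \<in> carrier_mat (2 * n) (2 * m)" "Y \<in> carrier_mat (2 * m) (2 * k)"
  shows "flat (X * Y) = flat Y * flat X"
proof (rule eq_matI)
  have XY: "X * Y \<in> carrier_mat (2 * n) (2 * k)" using assms by simp
  show "dim_row (flat (X * Y)) = dim_row (flat Y * flat X)"
    "dim_col (flat (X * Y)) = dim_col (flat Y * flat X)"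
    using assms by (auto simp: flat_eq[OF XY] flat_eq[of X n m] flat_eq[of Y m k])
  fix i j assume "i < dim_row (flat Y * flat X)" "j < dim_col (flat Y * flat X)"
  with assms have ij: "i < 2 * k" "j < 2 * n" by (auto simp: flat_eq[of X n m] flat_eq[of Y m k])
  then show "flat (X * Y) $$ (i, j) = (flat Y * flat X) $$ (i, j)"
    using assms
    by (auto simp: flat_eq[OF XY] flat_eq[of X n m] flat_eq[of Y m k] scalar_prod_def
        sum_distrib_left sum_distrib_right sig_def intro!: sum.cong)
qed

section \<open>Doubled-up matrices as the fixed points of a conjugation\<close>

text \<open>The permutation of a doubled-up index range that pairs each position with that of its
  conjugate.\<close>

definition swp :: "nat \<Rightarrow> nat \<Rightarrow> nat" where
  "swp r i = (if i < r then i + r else i - r)"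

lemma swp_less [simp]: "i < 2 * r \<Longrightarrow> swp r i < 2 * r"
  and swp_swp [simp]: "i < 2 * r \<Longrightarrow> swp r (swp r i) = i"
  by (auto simp: swp_def)

lemma sig_swp: "i < 2 * r \<Longrightarrow> sig r (swp r i) = - sig r i"
  by (auto simp: sig_def swp_def)

lemma sum_swp: "(\<Sum>i<2 * r. f (swp r i)) = (\<Sum>i<2 * r. f i)"
  by (rule sum.reindex_bij_witness[where i = "swp r" and j = "swp r"]) auto

text \<open>Entrywise conjugation combined with multiplication on both sides by the permutation
  matrices that exchange the two halves. The half sizes are taken from the dimensions of
  \<open>X\<close>.\<close>

definition dconj :: "complex mat \<Rightarrow> complex mat" where
  "dconj X = mat (dim_row X) (dim_col X)
     (\<lambda>(i, j). cnj (X $$ (swp (dim_row X div 2) i, swp (dim_col X div 2) j)))"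

lemma dconj_eq:
  "X \<in> carrier_mat (2 * r) (2 * k) \<Longrightarrow>
    dconj X = mat (2 * r) (2 * k) (\<lambda>(i, j). cnj (X $$ (swp r i, swp k j)))"
  by (auto simp: dconj_def)

lemma dconj_carrier [simp]:
  "X \<in> carrier_mat (2 * r) (2 * k) \<Longrightarrow> dconj X \<in> carrier_mat (2 * r) (2 * k)"
  by (simp add: dconj_eq)

lemma doubled_carrier [simp]:
  "Em \<in> carrier_mat r k \<Longrightarrow> Ep \<in> carrier_mat r k \<Longrightarrow> doubled Em Ep \<in> carrier_mat (2 * r) (2 * k)"
  by (auto simp: doubled_def)

lemma doubled_index:
  assumes "Em \<in> carrier_mat r k" "Ep \<in> carrier_mat r k" "i < 2 * r" "j < 2 * k"
  shows "doubled Em Ep $$ (i, j) =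
    (if i < r then if j < k then Em $$ (i, j) else Ep $$ (i, j - k)
     else if j < k then cnj (Ep $$ (i - r, j)) else cnj (Em $$ (i - r, j - k)))"
  using assms by (auto simp: doubled_def)

text \<open>The fixed-point equation says exactly that the two lower blocks are the conjugates of
  the two upper blocks taken crosswise. Closure of doubled-up form under an operation thus reduces
  to compatibility of that operation with \<open>dconj\<close>.\<close>

lemma is_doubled_iff:
  "is_doubled r k X \<longleftrightarrow> X \<in> carrier_mat (2 * r) (2 * k) \<and> dconj X = X"
proof
  assume "is_doubled r k X"
  then obtain Em Ep where E: "Em \<in> carrier_mat r k" "Ep \<in> carrier_mat r k" and X: "X = doubled Em Ep"
    by (auto simp: is_doubled_def)
  have "dconj X = X"
    unfolding X dconj_eq[OF doubled_carrier[OF E]] using doubled_carrier[OF E]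
    by (intro eq_matI) (auto simp: doubled_index[OF E] swp_def)
  with E X show "X \<in> carrier_mat (2 * r) (2 * k) \<and> dconj X = X" by simp
next
  assume *: "X \<in> carrier_mat (2 * r) (2 * k) \<and> dconj X = X"
  \<comment> \<open>The upper half of \<open>X\<close> supplies both blocks; the lower half is
    recovered from the fixed-point equation.\<close>
  define Em where "Em = mat r k (\<lambda>(i, j). X $$ (i, j))"
  define Ep where "Ep = mat r k (\<lambda>(i, j). X $$ (i, j + k))"
  have E: "Em \<in> carrier_mat r k" "Ep \<in> carrier_mat r k" by (auto simp: Em_def Ep_def)
  have fix_X: "X $$ (i, j) = cnj (X $$ (swp r i, swp k j))" if "i < 2 * r" "j < 2 * k" for i j
    using * that dconj_eq[of X r k] by (metis case_prod_conv index_mat(1))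
  have "X = doubled Em Ep"
  proof (rule eq_matI)
    fix i j assume "i < dim_row (doubled Em Ep)" "j < dim_col (doubled Em Ep)"
    then have ij: "i < 2 * r" "j < 2 * k" using doubled_carrier[OF E] by auto
    then show "X $$ (i, j) = doubled Em Ep $$ (i, j)"
      using fix_X[OF ij] unfolding doubled_index[OF E ij] by (auto simp: Em_def Ep_def swp_def)
  qed (use * doubled_carrier[OF E] in auto)
  with E show "is_doubled r k X" by (auto simp: is_doubled_def)
qed

text \<open>The exchange of halves acts on the summation index in both factors at once, so it is a
  mere reindexing of the sum.\<close>

lemma dconj_mult:
  assumes "X \<in> carrier_mat (2 * n) (2 * m)" "Y \<in> carrier_mat (2 * m) (2 * k)"
  shows "dconj (X * Y) = dconj X * dconj Y"
proof (rule eq_matI)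
  have XY: "X * Y \<in> carrier_mat (2 * n) (2 * k)" using assms by simp
  show "dim_row (dconj (X * Y)) = dim_row (dconj X * dconj Y)"
    "dim_col (dconj (X * Y)) = dim_col (dconj X * dconj Y)"
    by (auto simp: dconj_def)
  fix i j assume "i < dim_row (dconj X * dconj Y)" "j < dim_col (dconj X * dconj Y)"
  with assms have ij: "i < 2 * n" "j < 2 * k" by (auto simp: dconj_def)
  have "(dconj X * dconj Y) $$ (i, j)
      = (\<Sum>l<2 * m. cnj (X $$ (swp n i, swp m l)) * cnj (Y $$ (swp m l, swp k j)))"
    using ij assms
    by (auto simp: dconj_eq[of X n m] dconj_eq[of Y m k] scalar_prod_def atLeast0LessThan
        intro!: sum.cong)
  also have "\<dots> = (\<Sum>l<2 * m. cnj (X $$ (swp n i, l)) * cnj (Y $$ (l, swp k j)))"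
    by (rule sum_swp)
  also have "\<dots> = dconj (X * Y) $$ (i, j)"
    using ij assms by (auto simp: dconj_eq[OF XY] scalar_prod_def atLeast0LessThan)
  finally show "dconj (X * Y) $$ (i, j) = (dconj X * dconj Y) $$ (i, j)" by simp
qed

lemma is_doubled_add: "is_doubled r k X \<Longrightarrow> is_doubled r k Y \<Longrightarrow> is_doubled r k (X + Y)"
  and is_doubled_minus: "is_doubled r k X \<Longrightarrow> is_doubled r k Y \<Longrightarrow> is_doubled r k (X - Y)"
proof -
  assume *: "is_doubled r k X" "is_doubled r k Y"
  then have X: "X \<in> carrier_mat (2 * r) (2 * k)" "dconj X = X"
    and Y: "Y \<in> carrier_mat (2 * r) (2 * k)" "dconj Y = Y" by (auto simp: is_doubled_iff)
  have "dconj (X + Y) = dconj X + dconj Y" "dconj (X - Y) = dconj X - dconj Y"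
    using X(1) Y(1) by (auto simp: dconj_def intro!: eq_matI)
  with X Y show "is_doubled r k (X + Y)" "is_doubled r k (X - Y)"
    by (auto simp: is_doubled_iff minus_carrier_mat)
qed

text \<open>The factor is real because \<open>dconj\<close> is conjugate-linear.\<close>

lemma is_doubled_smult: "is_doubled r k X \<Longrightarrow> is_doubled r k (of_real c \<cdot>\<^sub>m X)"
proof -
  assume "is_doubled r k X"
  then have X: "X \<in> carrier_mat (2 * r) (2 * k)" "dconj X = X" by (auto simp: is_doubled_iff)
  have "dconj (of_real c \<cdot>\<^sub>m X) = of_real c \<cdot>\<^sub>m dconj X"
    using X(1) by (auto simp: dconj_def intro!: eq_matI)
  with X show "is_doubled r k (of_real c \<cdot>\<^sub>m X)" by (auto simp: is_doubled_iff)
qed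

lemma is_doubled_mult: "is_doubled n m X \<Longrightarrow> is_doubled m k Y \<Longrightarrow> is_doubled n k (X * Y)"
  by (auto simp: is_doubled_iff dconj_mult[of _ n m _ k])

text \<open>Exchanging halves reverses both the row sign and the column sign in \<open>flat\<close>;
  the two reversals cancel, so \<open>flat\<close> commutes with \<open>dconj\<close>.\<close>

lemma is_doubled_flat: "is_doubled n m X \<Longrightarrow> is_doubled m n (flat X)"
proof -
  assume "is_doubled n m X"
  then have X: "X \<in> carrier_mat (2 * n) (2 * m)" "dconj X = X" by (auto simp: is_doubled_iff)
  have "dconj (flat X) = flat (dconj X)"
    using X(1) by (intro eq_matI)
      (auto simp: dconj_eq[of _ n m] dconj_eq[of _ m n] flat_eq[of _ n m] sig_swp)
  with X show ?thesis by (auto simp: is_doubled_iff)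
qed

lemma is_doubled_one: "is_doubled n n (1\<^sub>m (2 * n))"
proof -
  have "dconj (1\<^sub>m (2 * n)) = 1\<^sub>m (2 * n)"
    by (intro eq_matI) (auto simp: dconj_eq[of _ n n] swp_def)
  then show ?thesis by (auto simp: is_doubled_iff)
qed

text \<open>Applying \<open>dconj\<close> to \<open>Y * R\<close> shows that \<open>dconj R\<close>
  is again a right inverse of \<open>Y\<close>; uniqueness of the inverse forces it to be
  \<open>R\<close>.\<close>

lemma is_doubled_inverse:
  assumes Y: "is_doubled n n Y" and R: "R \<in> carrier_mat (2 * n) (2 * n)"
    and YR: "Y * R = 1\<^sub>m (2 * n)" and RY: "R * Y = 1\<^sub>m (2 * n)"
  shows "is_doubled n n R"
proof -
  have Y': "Y \<in> carrier_mat (2 * n) (2 * n)" "dconj Y = Y" using Y by (auto simp: is_doubled_iff)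
  have "Y * dconj R = dconj (Y * R)"
    using Y' R by (simp add: dconj_mult[of _ n n _ n])
  also have "\<dots> = 1\<^sub>m (2 * n)" using YR is_doubled_one by (simp add: is_doubled_iff)
  finally have "R * Y * dconj R = R"
    using R Y' by (subst assoc_mult_mat[of _ _ "2 * n" _ "2 * n" _ "2 * n"]) auto
  then have "dconj R = R" using RY left_mult_one_mat[OF dconj_carrier[OF R]] by simp
  with R show ?thesis by (simp add: is_doubled_iff)
qed

section \<open>Splitting the channels into two groups\<close>

text \<open>\<open>emb1\<close> and \<open>emb2\<close> give the positions in the doubled-up vector of \<open>(b1, b2)\<close>, which is ordered
  as \<open>(b1, b2, b1\<^sup>#, b2\<^sup>#)\<close>, of the entries of the doubled-up vectors of \<open>b1\<close> and of \<open>b2\<close>.\<close>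

definition emb1 :: "nat \<Rightarrow> nat \<Rightarrow> nat \<Rightarrow> nat" where
  "emb1 n1 n2 p = (if p < n1 then p else p + n2)"

definition emb2 :: "nat \<Rightarrow> nat \<Rightarrow> nat \<Rightarrow> nat" where
  "emb2 n1 n2 p = (if p < n2 then p + n1 else p + 2 * n1)"

lemma emb_less [simp]:
  "p < 2 * n1 \<Longrightarrow> emb1 n1 n2 p < 2 * (n1 + n2)"
  "p < 2 * n2 \<Longrightarrow> emb2 n1 n2 p < 2 * (n1 + n2)"
  by (auto simp: emb1_def emb2_def distrib_left_numeral)

text \<open>Both embeddings keep an index in its half of the doubled-up vector. This is what makes
  \<open>flat\<close> compatible with the splitting into channel groups.\<close>

lemma sig_emb:
  "p < 2 * n1 \<Longrightarrow> sig (n1 + n2) (emb1 n1 n2 p) = sig n1 p"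
  "p < 2 * n2 \<Longrightarrow> sig (n1 + n2) (emb2 n1 n2 p) = sig n2 p"
  by (auto simp: emb1_def emb2_def sig_def)

lemma emb_eq_iff:
  "p < 2 * n1 \<Longrightarrow> q < 2 * n1 \<Longrightarrow> emb1 n1 n2 p = emb1 n1 n2 q \<longleftrightarrow> p = q"
  "p < 2 * n2 \<Longrightarrow> q < 2 * n2 \<Longrightarrow> emb2 n1 n2 p = emb2 n1 n2 q \<longleftrightarrow> p = q"
  "p < 2 * n1 \<Longrightarrow> q < 2 * n2 \<Longrightarrow> emb1 n1 n2 p \<noteq> emb2 n1 n2 q"
  by (auto simp: emb1_def emb2_def)

lemma emb_cases:
  assumes "i < 2 * (n1 + n2)"
  obtains p where "p < 2 * n1" "i = emb1 n1 n2 p" | p where "p < 2 * n2" "i = emb2 n1 n2 p"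
proof -
  \<comment> \<open>The four ranges are the positions of \<open>b1\<close>, \<open>b2\<close>, the
    conjugates of \<open>b1\<close> and the conjugates of \<open>b2\<close>.\<close>
  consider "i < n1" | "n1 \<le> i" "i < n1 + n2" | "n1 + n2 \<le> i" "i < 2 * n1 + n2" | "2 * n1 + n2 \<le> i"
    by linarith
  then show thesis
  proof cases
    case 1 then show thesis using that(1)[of i] by (auto simp: emb1_def)
  next
    case 2
    then have "i - n1 < n2" "i = emb2 n1 n2 (i - n1)" by (auto simp: emb2_def)
    then show thesis using that(2)[of "i - n1"] by simp
  next
    case 3 then show thesis using that(1)[of "i - n2"] by (auto simp: emb1_def)
  next
    case 4 then show thesis using that(2)[of "i - 2 * n1"] assms
      by (auto simp: emb2_def distrib_left_numeral)
  qed
qed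

lemma sum_emb:
  "(\<Sum>i<2 * (n1 + n2). f i) = (\<Sum>p<2 * n1. f (emb1 n1 n2 p)) + (\<Sum>p<2 * n2. f (emb2 n1 n2 p))"
proof -
  let ?A = "emb1 n1 n2 ` {..<2 * n1}" and ?B = "emb2 n1 n2 ` {..<2 * n2}"
  have "{..<2 * (n1 + n2)} = ?A \<union> ?B"
    by (auto elim: emb_cases)
  moreover have "?A \<inter> ?B = {}"
    by (auto simp: emb_eq_iff)
  ultimately have "(\<Sum>i<2 * (n1 + n2). f i) = sum f ?A + sum f ?B"
    by (simp add: sum.union_disjoint)
  also have "sum f ?A = (\<Sum>p<2 * n1. f (emb1 n1 n2 p))"
    by (subst sum.reindex) (auto simp: inj_on_def emb_eq_iff)
  also have "sum f ?B = (\<Sum>p<2 * n2. f (emb2 n1 n2 p))"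
    by (subst sum.reindex) (auto simp: inj_on_def emb_eq_iff)
  finally show ?thesis .
qed

text \<open>A submatrix selected by index maps. A channel group together with its conjugates is in
  general not a contiguous range of the doubled-up vector, hence maps instead of intervals.\<close>

definition block :: "(nat \<Rightarrow> nat) \<Rightarrow> nat \<Rightarrow> (nat \<Rightarrow> nat) \<Rightarrow> nat \<Rightarrow> 'a mat \<Rightarrow> 'a mat" where
  "block f r g k M = mat r k (\<lambda>(i, j). M $$ (f i, g j))"

lemma block_carrier [simp]: "block f r g k M \<in> carrier_mat r k"
  by (simp add: block_def)

lemma block_index: "i < r \<Longrightarrow> j < k \<Longrightarrow> block f r g k M $$ (i, j) = M $$ (f i, g j)"
  by (simp add: block_def)

lemma block_eqI:
  assumes "A \<in> carrier_mat r k" "\<And>i j. i < r \<Longrightarrow> j < k \<Longrightarrow> M $$ (f i, g j) = A $$ (i, j)"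
  shows "block f r g k M = A"
  using assms by (intro eq_matI) (auto simp: block_def)

lemma block_mult:
  fixes M N :: "'a::semiring_0 mat"
  assumes "M \<in> carrier_mat a (2 * (n1 + n2))" "N \<in> carrier_mat (2 * (n1 + n2)) b"
    and f: "\<And>i. i < r \<Longrightarrow> f i < a" and g: "\<And>j. j < k \<Longrightarrow> g j < b"
  shows "block f r g k (M * N) =
      block f r (emb1 n1 n2) (2 * n1) M * block (emb1 n1 n2) (2 * n1) g k N +
      block f r (emb2 n1 n2) (2 * n2) M * block (emb2 n1 n2) (2 * n2) g k N"
proof (rule block_eqI)
  fix i j assume ij: "i < r" "j < k"
  have "(M * N) $$ (f i, g j) = (\<Sum>l<2 * (n1 + n2). M $$ (f i, l) * N $$ (l, g j))"
    using assms ij by (auto simp: scalar_prod_def atLeast0LessThan)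
  then show "(M * N) $$ (f i, g j) =
      (block f r (emb1 n1 n2) (2 * n1) M * block (emb1 n1 n2) (2 * n1) g k N +
       block f r (emb2 n1 n2) (2 * n2) M * block (emb2 n1 n2) (2 * n2) g k N) $$ (i, j)"
    using ij by (simp add: block_def sum_emb scalar_prod_def atLeast0LessThan)
qed (auto simp: block_def)

lemma flat_block:
  assumes "X \<in> carrier_mat (2 * n) (2 * m)"
    and f: "\<And>i. i < 2 * r \<Longrightarrow> f i < 2 * n \<and> sig n (f i) = sig r i"
    and g: "\<And>j. j < 2 * k \<Longrightarrow> g j < 2 * m \<and> sig m (g j) = sig k j"
  shows "flat (block f (2 * r) g (2 * k) X) = block g (2 * k) f (2 * r) (flat X)"
  using assms
  by (intro eq_matI) (auto simp: flat_eq[of _ n m] flat_eq[of _ r k] block_def)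

text \<open>Selecting a group of channels along with its conjugates commutes with doubling up. This
  links the partition of \<open>Sm\<close> and \<open>Sp\<close> to the blocks \<open>S11\<close>,
  \<open>S12\<close>, \<open>S21\<close>, \<open>S22\<close> of the doubled-up scattering
  matrix.\<close>

lemma doubled_four_block:
  assumes "Em11 \<in> carrier_mat n1 m1" "Em12 \<in> carrier_mat n1 m2"
          "Em21 \<in> carrier_mat n2 m1" "Em22 \<in> carrier_mat n2 m2"
          "Ep11 \<in> carrier_mat n1 m1" "Ep12 \<in> carrier_mat n1 m2"
          "Ep21 \<in> carrier_mat n2 m1" "Ep22 \<in> carrier_mat n2 m2"
  defines "X \<equiv> doubled (four_block_mat Em11 Em12 Em21 Em22) (four_block_mat Ep11 Ep12 Ep21 Ep22)"
  shows "block (emb1 n1 n2) (2 * n1) (emb1 m1 m2) (2 * m1) X = doubled Em11 Ep11"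
    and "block (emb1 n1 n2) (2 * n1) (emb2 m1 m2) (2 * m2) X = doubled Em12 Ep12"
    and "block (emb2 n1 n2) (2 * n2) (emb1 m1 m2) (2 * m1) X = doubled Em21 Ep21"
    and "block (emb2 n1 n2) (2 * n2) (emb2 m1 m2) (2 * m2) X = doubled Em22 Ep22"
proof -
  have E: "four_block_mat Em11 Em12 Em21 Em22 \<in> carrier_mat (n1 + n2) (m1 + m2)"
    "four_block_mat Ep11 Ep12 Ep21 Ep22 \<in> carrier_mat (n1 + n2) (m1 + m2)"
    using assms by auto
  show "block (emb1 n1 n2) (2 * n1) (emb1 m1 m2) (2 * m1) X = doubled Em11 Ep11"
    using assms(1-8)
    by (intro block_eqI, simp, simp add: X_def doubled_index[OF E] doubled_index[OF assms(1,5)])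
      (auto simp: emb1_def emb2_def)
  show "block (emb1 n1 n2) (2 * n1) (emb2 m1 m2) (2 * m2) X = doubled Em12 Ep12"
    using assms(1-8)
    by (intro block_eqI, simp, simp add: X_def doubled_index[OF E] doubled_index[OF assms(2,6)])
      (auto simp: emb1_def emb2_def)
  show "block (emb2 n1 n2) (2 * n2) (emb1 m1 m2) (2 * m1) X = doubled Em21 Ep21"
    using assms(1-8)
    by (intro block_eqI, simp, simp add: X_def doubled_index[OF E] doubled_index[OF assms(3,7)])
      (auto simp: emb1_def emb2_def)
  show "block (emb2 n1 n2) (2 * n2) (emb2 m1 m2) (2 * m2) X = doubled Em22 Ep22"
    using assms(1-8)
    by (intro block_eqI, simp, simp add: X_def doubled_index[OF E] doubled_index[OF assms(4,8)])
      (auto simp: emb1_def emb2_def)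
qed

text \<open>The counterpart for the coupling matrix, whose columns belong to the modes and are not
  split; hence the column map \<open>id\<close>.\<close>

lemma doubled_append_rows:
  assumes "Em1 \<in> carrier_mat n1 m" "Em2 \<in> carrier_mat n2 m"
          "Ep1 \<in> carrier_mat n1 m" "Ep2 \<in> carrier_mat n2 m"
  defines "X \<equiv> doubled (Em1 @\<^sub>r Em2) (Ep1 @\<^sub>r Ep2)"
  shows "block (emb1 n1 n2) (2 * n1) id (2 * m) X = doubled Em1 Ep1"
    and "block (emb2 n1 n2) (2 * n2) id (2 * m) X = doubled Em2 Ep2"
proof -
  have E: "Em1 @\<^sub>r Em2 \<in> carrier_mat (n1 + n2) m" "Ep1 @\<^sub>r Ep2 \<in> carrier_mat (n1 + n2) m"
    using assms by auto
  show "block (emb1 n1 n2) (2 * n1) id (2 * m) X = doubled Em1 Ep1"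
    using assms(1-4)
    by (intro block_eqI, simp, simp add: X_def doubled_index[OF E] doubled_index[OF assms(1,3)])
      (auto simp: emb1_def emb2_def append_rows_def)
  show "block (emb2 n1 n2) (2 * n2) id (2 * m) X = doubled Em2 Ep2"
    using assms(1-4)
    by (intro block_eqI, simp, simp add: X_def doubled_index[OF E] doubled_index[OF assms(2,4)])
      (auto simp: emb1_def emb2_def append_rows_def)
qed

text \<open>The entries of \<open>M\<close> go to the rows \<open>emb1\<close>, those of \<open>N\<close> to the rows \<open>emb2\<close>.\<close>

definition stack :: "nat \<Rightarrow> nat \<Rightarrow> 'a mat \<Rightarrow> 'a mat \<Rightarrow> 'a mat" where
  "stack n1 n2 M N = mat (2 * (n1 + n2)) (dim_col M) (\<lambda>(i, j).
     if i < n1 then M $$ (i, j) else if i < n1 + n2 then N $$ (i - n1, j)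
     else if i < 2 * n1 + n2 then M $$ (i - n2, j) else N $$ (i - 2 * n1, j))"

lemma stack_carrier [simp]: "dim_col M = k \<Longrightarrow> stack n1 n2 M N \<in> carrier_mat (2 * (n1 + n2)) k"
  by (auto simp: stack_def)

lemma block_stack:
  assumes "M \<in> carrier_mat (2 * n1) k" "N \<in> carrier_mat (2 * n2) k"
  shows "block (emb1 n1 n2) (2 * n1) id k (stack n1 n2 M N) = M"
    and "block (emb2 n1 n2) (2 * n2) id k (stack n1 n2 M N) = N"
  using assms
  by (intro block_eqI, simp, simp add: stack_def, auto simp: emb1_def emb2_def distrib_left_numeral)+

text \<open>The images of \<open>emb1\<close> and \<open>emb2\<close> exhaust the rows, so the two
  row blocks determine the matrix.\<close>

lemma stack_eqI:
  assumes "X \<in> carrier_mat (2 * (n1 + n2)) k"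
    "block (emb1 n1 n2) (2 * n1) id k X = M" "block (emb2 n1 n2) (2 * n2) id k X = N"
  shows "X = stack n1 n2 M N"
proof (rule eq_matI)
  have MN: "M \<in> carrier_mat (2 * n1) k" "N \<in> carrier_mat (2 * n2) k"
    using block_carrier[of "emb1 n1 n2" "2 * n1" id k X] block_carrier[of "emb2 n1 n2" "2 * n2" id k X]
      assms by simp_all
  show "dim_row X = dim_row (stack n1 n2 M N)" "dim_col X = dim_col (stack n1 n2 M N)"
    using assms(1) MN by (auto simp: stack_def)
  fix i j assume "i < dim_row (stack n1 n2 M N)" "j < dim_col (stack n1 n2 M N)"
  then have i: "i < 2 * (n1 + n2)" and j: "j < k" using MN by (auto simp: stack_def)
  from i show "X $$ (i, j) = stack n1 n2 M N $$ (i, j)"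
  proof (cases rule: emb_cases)
    case (1 p)
    then show ?thesis
      using j block_index[of p "2 * n1" j k "emb1 n1 n2" id] assms(2) block_stack(1)[OF MN]
      by (metis id_apply)
  next
    case (2 p)
    then show ?thesis
      using j block_index[of p "2 * n2" j k "emb2 n1 n2" id] assms(3) block_stack(2)[OF MN]
      by (metis id_apply)
  qed
qed

lemma block_id: "X \<in> carrier_mat r k \<Longrightarrow> block id r id k X = X"
  by (rule block_eqI) auto

lemma block_add:
  assumes "X \<in> carrier_mat a b" "Y \<in> carrier_mat a b" "\<And>i. i < r \<Longrightarrow> f i < a" "\<And>j. j < k \<Longrightarrow> g j < b"
  shows "block f r g k (X + Y) = block f r g k X + block f r g k Y"
  using assms by (intro eq_matI) (auto simp: block_def)

text \<open>The indefinite form is an orthogonal sum over the two channel groups: the row sum splits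
  along the embeddings, which preserve signs.\<close>

lemma flat_stack_mult:
  assumes "M \<in> carrier_mat (2 * n1) (2 * k)" "N \<in> carrier_mat (2 * n2) (2 * k)"
    and "P \<in> carrier_mat (2 * n1) (2 * l)" "Q \<in> carrier_mat (2 * n2) (2 * l)"
  shows "flat (stack n1 n2 M N) * stack n1 n2 P Q = flat M * P + flat N * Q"
proof -
  let ?X = "stack n1 n2 M N" and ?Y = "stack n1 n2 P Q"
  have X: "?X \<in> carrier_mat (2 * (n1 + n2)) (2 * k)" and Y: "?Y \<in> carrier_mat (2 * (n1 + n2)) (2 * l)"
    using assms by auto
  have "flat M = block id (2 * k) (emb1 n1 n2) (2 * n1) (flat ?X)"
    using flat_block[OF X, of n1 "emb1 n1 n2" k id] block_stack(1)[OF assms(1,2)] sig_emb by simp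
  moreover have "flat N = block id (2 * k) (emb2 n1 n2) (2 * n2) (flat ?X)"
    using flat_block[OF X, of n2 "emb2 n1 n2" k id] block_stack(2)[OF assms(1,2)] sig_emb by simp
  moreover have "flat ?X * ?Y = block id (2 * k) id (2 * l) (flat ?X * ?Y)"
    using X Y by (intro block_id[symmetric]) (auto intro!: mult_carrier_mat)
  ultimately show ?thesis
    using block_mult[OF flat_carrier[OF X] Y, of "2 * k" id "2 * l" id] block_stack[OF assms(3,4)]
    by simp
qed

lemma mult_stack:
  assumes X: "X \<in> carrier_mat (2 * (n1 + n2)) (2 * (n1 + n2))"
    and "P \<in> carrier_mat (2 * n1) l" "Q \<in> carrier_mat (2 * n2) l"
  shows "X * stack n1 n2 P Q = stack n1 n2
    (block (emb1 n1 n2) (2 * n1) (emb1 n1 n2) (2 * n1) X * P +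
     block (emb1 n1 n2) (2 * n1) (emb2 n1 n2) (2 * n2) X * Q)
    (block (emb2 n1 n2) (2 * n2) (emb1 n1 n2) (2 * n1) X * P +
     block (emb2 n1 n2) (2 * n2) (emb2 n1 n2) (2 * n2) X * Q)"
proof (rule stack_eqI)
  have Y: "stack n1 n2 P Q \<in> carrier_mat (2 * (n1 + n2)) l" using assms by auto
  show "X * stack n1 n2 P Q \<in> carrier_mat (2 * (n1 + n2)) l" using X Y by auto
  show "block (emb1 n1 n2) (2 * n1) id l (X * stack n1 n2 P Q) =
    block (emb1 n1 n2) (2 * n1) (emb1 n1 n2) (2 * n1) X * P +
     block (emb1 n1 n2) (2 * n1) (emb2 n1 n2) (2 * n2) X * Q"
    using block_mult[OF X Y, of "2 * n1" "emb1 n1 n2" l id] block_stack[OF assms(2,3)] by simp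
  show "block (emb2 n1 n2) (2 * n2) id l (X * stack n1 n2 P Q) =
    block (emb2 n1 n2) (2 * n2) (emb1 n1 n2) (2 * n1) X * P +
     block (emb2 n1 n2) (2 * n2) (emb2 n1 n2) (2 * n2) X * Q"
    using block_mult[OF X Y, of "2 * n2" "emb2 n1 n2" l id] block_stack[OF assms(2,3)] by simp
qed

lemma stack_add:
  assumes "M \<in> carrier_mat (2 * n1) k" "N \<in> carrier_mat (2 * n2) k"
    "P \<in> carrier_mat (2 * n1) k" "Q \<in> carrier_mat (2 * n2) k"
  shows "stack n1 n2 M N + stack n1 n2 P Q = stack n1 n2 (M + P) (N + Q)"
  using assms block_stack[OF assms(1,2)] block_stack[OF assms(3,4)]
  by (intro stack_eqI[where k = k]) (auto simp: block_add[of _ "2 * (n1 + n2)" k])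

section \<open>The action of matrices on vectors of operators\<close>

lemma mat_act_carrier [simp]: "M \<in> carrier_mat r k \<Longrightarrow> mat_act scale M x \<in> carrier_vec r"
  by (auto simp: mat_act_def)

lemma breve_carrier [simp]: "x \<in> carrier_vec n \<Longrightarrow> breve star x \<in> carrier_vec (2 * n)"
  by (auto simp: breve_def intro!: carrier_vecI)

lemma dim_breve [simp]: "dim_vec (breve star x) = 2 * dim_vec x"
  by (simp add: breve_def)

lemma breve_index:
  "x \<in> carrier_vec n \<Longrightarrow> i < 2 * n \<Longrightarrow>
    breve star x $ i = (if i < n then x $ i else star (x $ (i - n)))"
  by (auto simp: breve_def)

lemma mat_act_index:
  "M \<in> carrier_mat r k \<Longrightarrow> x \<in> carrier_vec k \<Longrightarrow> i < r \<Longrightarrow>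
    mat_act scale M x $ i = (\<Sum>j<k. scale (M $$ (i, j)) (x $ j))"
  by (auto simp: mat_act_def)

context star_vector_space
begin

lemma mat_act_add:
  assumes "M \<in> carrier_mat r k" "N \<in> carrier_mat r k" "x \<in> carrier_vec k"
  shows "mat_act scale (M + N) x = mat_act scale M x + mat_act scale N x"
  using assms by (intro eq_vecI) (auto simp: mat_act_def scale_left_distrib sum.distrib)

lemma mat_act_minus:
  assumes "M \<in> carrier_mat r k" "N \<in> carrier_mat r k" "x \<in> carrier_vec k"
  shows "mat_act scale (M - N) x = mat_act scale M x - mat_act scale N x"
  using assms by (intro eq_vecI) (auto simp: mat_act_def scale_left_diff_distrib sum_subtractf)

lemma mat_act_add_vec:
  assumes "M \<in> carrier_mat r k" "x \<in> carrier_vec k" "y \<in> carrier_vec k"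
  shows "mat_act scale M (x + y) = mat_act scale M x + mat_act scale M y"
  using assms by (intro eq_vecI) (auto simp: mat_act_def scale_right_distrib sum.distrib)

lemma mat_act_mult:
  assumes "M \<in> carrier_mat r k" "N \<in> carrier_mat k l" "x \<in> carrier_vec l"
  shows "mat_act scale (M * N) x = mat_act scale M (mat_act scale N x)"
proof (rule eq_vecI)
  show "dim_vec (mat_act scale (M * N) x) = dim_vec (mat_act scale M (mat_act scale N x))"
    by (simp add: mat_act_def)
  fix i assume "i < dim_vec (mat_act scale M (mat_act scale N x))"
  then have i: "i < r" using assms by (simp add: mat_act_def)
  have "mat_act scale (M * N) x $ i = (\<Sum>j<l. \<Sum>h<k. scale (M $$ (i, h) * N $$ (h, j)) (x $ j))"
    using assms i by (auto simp: mat_act_def scalar_prod_def scale_sum_left atLeast0LessThan)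
  also have "\<dots> = (\<Sum>h<k. \<Sum>j<l. scale (M $$ (i, h) * N $$ (h, j)) (x $ j))"
    by (rule sum.swap)
  also have "\<dots> = mat_act scale M (mat_act scale N x) $ i"
    using assms i by (auto simp: mat_act_def scale_sum_right intro!: sum.cong)
  finally show "mat_act scale (M * N) x $ i = mat_act scale M (mat_act scale N x) $ i" .
qed

lemma mat_act_one: "x \<in> carrier_vec k \<Longrightarrow> mat_act scale (1\<^sub>m k) x = x"
proof (rule eq_vecI)
  fix i assume "x \<in> carrier_vec k" "i < dim_vec x"
  moreover have "(\<Sum>j<k. scale ((1\<^sub>m k :: complex mat) $$ (i, j)) (x $ j))
      = (\<Sum>j<k. if i = j then x $ j else 0)" if "i < k"
    using that by (intro sum.cong) auto
  ultimately show "mat_act scale (1\<^sub>m k) x $ i = x $ i"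
    by (auto simp: mat_act_def)
qed (auto simp: mat_act_def)

lemma star_zero [simp]: "star 0 = 0"
  using star_add[of 0 0] by simp

lemma star_sum: "star (sum f I) = (\<Sum>i\<in>I. star (f i))"
  by (induction I rule: infinite_finite_induct) (auto simp: star_add)

text \<open>The vector analogue of the fixed-point description of doubled-up matrices; that
  \<open>star\<close> is an involution gives the entries of the upper half.\<close>

lemma breve_iff:
  "(\<exists>x \<in> carrier_vec n. y = breve star x) \<longleftrightarrow>
    y \<in> carrier_vec (2 * n) \<and> (\<forall>i<2 * n. star (y $ swp n i) = y $ i)"
proof
  assume "\<exists>x \<in> carrier_vec n. y = breve star x"
  then show "y \<in> carrier_vec (2 * n) \<and> (\<forall>i<2 * n. star (y $ swp n i) = y $ i)"
    by (auto simp: breve_index[of _ n] swp_def star_star)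
next
  assume *: "y \<in> carrier_vec (2 * n) \<and> (\<forall>i<2 * n. star (y $ swp n i) = y $ i)"
  define x where "x = vec n (\<lambda>i. y $ i)"
  have x: "x \<in> carrier_vec n" by (simp add: x_def)
  have "y = breve star x"
  proof (rule eq_vecI)
    fix i assume "i < dim_vec (breve star x)"
    then have i: "i < 2 * n" using x by simp
    with * have "star (y $ swp n i) = y $ i" by blast
    then show "y $ i = breve star x $ i"
      unfolding breve_index[OF x i] using i by (auto simp: x_def swp_def)
  qed (use * x in auto)
  with x show "\<exists>x \<in> carrier_vec n. y = breve star x" by blast
qed

lemma breve_add:
  assumes "x \<in> carrier_vec n" "y \<in> carrier_vec n"
  shows "breve star x + breve star y = breve star (x + y)"
  using assms by (intro eq_vecI) (auto simp: breve_def star_add)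

text \<open>Needed for the existence of loop signals: the solution of the loop equation must itself
  be the doubled-up vector of some field.\<close>

lemma mat_act_breve:
  assumes M: "is_doubled r k M" and x: "x \<in> carrier_vec k"
  shows "\<exists>y \<in> carrier_vec r. mat_act scale M (breve star x) = breve star y"
proof -
  have M': "M \<in> carrier_mat (2 * r) (2 * k)" "dconj M = M" using M by (auto simp: is_doubled_iff)
  have fix_x: "star (breve star x $ swp k j) = breve star x $ j" if "j < 2 * k" for j
    using breve_iff[of k "breve star x"] x that by blast
  have fix_M: "cnj (M $$ (swp r i, swp k j)) = M $$ (i, j)" if "i < 2 * r" "j < 2 * k" for i j
    using M' that dconj_eq[of M r k] by (metis case_prod_conv index_mat(1))
  have "star (mat_act scale M (breve star x) $ swp r i) = mat_act scale M (breve star x) $ i"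
    if i: "i < 2 * r" for i
  proof -
    have "star (mat_act scale M (breve star x) $ swp r i)
        = (\<Sum>j<2 * k. scale (cnj (M $$ (swp r i, j))) (star (breve star x $ j)))"
      using i M' x by (simp add: mat_act_index[of _ "2 * r" "2 * k"] star_sum star_scale)
    \<comment> \<open>Reindexing by the exchange of halves makes the fixed-point equations of both
      \<open>M\<close> and the vector applicable.\<close>
    also have "\<dots> = (\<Sum>j<2 * k. scale (cnj (M $$ (swp r i, swp k j))) (star (breve star x $ swp k j)))"
      by (rule sum_swp[symmetric])
    also have "\<dots> = (\<Sum>j<2 * k. scale (M $$ (i, j)) (breve star x $ j))"
      using i fix_x fix_M by (intro sum.cong) auto
    also have "\<dots> = mat_act scale M (breve star x) $ i"
      using i M' x by (simp add: mat_act_index[of _ "2 * r" "2 * k"])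
    finally show ?thesis .
  qed
  then show ?thesis
    using M' breve_iff[of r "mat_act scale M (breve star x)"] by (metis mat_act_carrier)
qed

text \<open>The input sum splits along the two channel groups, while \<open>f\<close> selects the
  output rows of interest.\<close>

lemma mat_act_append:
  assumes M: "M \<in> carrier_mat r (2 * (n1 + n2))" and x: "x \<in> carrier_vec n1" "y \<in> carrier_vec n2"
    and f: "\<And>i. i < a \<Longrightarrow> f i < r"
  shows "vec a (\<lambda>i. mat_act scale M (breve star (x @\<^sub>v y)) $ f i) =
    mat_act scale (block f a (emb1 n1 n2) (2 * n1) M) (breve star x) +
    mat_act scale (block f a (emb2 n1 n2) (2 * n2) M) (breve star y)"
proof (rule eq_vecI)
  let ?w = "breve star (x @\<^sub>v y)"
  have xy: "x @\<^sub>v y \<in> carrier_vec (n1 + n2)" using x by auto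
  have 1: "?w $ emb1 n1 n2 p = breve star x $ p" if "p < 2 * n1" for p
    using that x by (simp add: breve_index[OF xy] breve_index[of x n1]) (auto simp: emb1_def)
  have 2: "?w $ emb2 n1 n2 p = breve star y $ p" if "p < 2 * n2" for p
    using that x by (simp add: breve_index[OF xy] breve_index[of y n2]) (auto simp: emb2_def)
  fix i
  assume "i < dim_vec (mat_act scale (block f a (emb1 n1 n2) (2 * n1) M) (breve star x) +
    mat_act scale (block f a (emb2 n1 n2) (2 * n2) M) (breve star y))"
  then have i: "i < a" by (simp add: mat_act_def block_def)
  have "mat_act scale M ?w $ f i = (\<Sum>j<2 * (n1 + n2). scale (M $$ (f i, j)) (?w $ j))"
    using M f[OF i] breve_carrier[OF xy] by (intro mat_act_index) auto
  also have "\<dots> = (\<Sum>j<2 * n1. scale (M $$ (f i, emb1 n1 n2 j)) (breve star x $ j)) +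
      (\<Sum>j<2 * n2. scale (M $$ (f i, emb2 n1 n2 j)) (breve star y $ j))"
    by (simp add: sum_emb 1 2)
  also have "\<dots> = (mat_act scale (block f a (emb1 n1 n2) (2 * n1) M) (breve star x) +
    mat_act scale (block f a (emb2 n1 n2) (2 * n2) M) (breve star y)) $ i"
    using i x by (simp add: mat_act_def block_def)
  finally show "vec a (\<lambda>i. mat_act scale M ?w $ f i) $ i = \<dots>" using i by simp
qed (auto simp: mat_act_def block_def)

text \<open>Equality with a joint doubled-up vector can be tested on each channel group, because
  \<open>emb1\<close> and \<open>emb2\<close> exhaust the positions.\<close>

lemma breve_append_eq_iff:
  assumes x: "x \<in> carrier_vec n1" "y \<in> carrier_vec n2" and z: "z \<in> carrier_vec (2 * (n1 + n2))"
  shows "breve star (x @\<^sub>v y) = z \<longleftrightarrow>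
    breve star x = vec (2 * n1) (\<lambda>i. z $ emb1 n1 n2 i) \<and>
    breve star y = vec (2 * n2) (\<lambda>i. z $ emb2 n1 n2 i)"
proof -
  let ?w = "breve star (x @\<^sub>v y)"
  have xy: "x @\<^sub>v y \<in> carrier_vec (n1 + n2)" using x by auto
  have 1: "breve star x = vec (2 * n1) (\<lambda>i. ?w $ emb1 n1 n2 i)"
    using x by (intro eq_vecI) (auto simp: breve_index[OF xy] breve_index[of x n1] emb1_def breve_def)
  have 2: "breve star y = vec (2 * n2) (\<lambda>i. ?w $ emb2 n1 n2 i)"
    using x by (intro eq_vecI) (auto simp: breve_index[OF xy] breve_index[of y n2] emb2_def breve_def)
  show ?thesis
  proof
    assume "?w = z" then show "breve star x = vec (2 * n1) (\<lambda>i. z $ emb1 n1 n2 i) \<and>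
      breve star y = vec (2 * n2) (\<lambda>i. z $ emb2 n1 n2 i)" using 1 2 by simp
  next
    assume *: "breve star x = vec (2 * n1) (\<lambda>i. z $ emb1 n1 n2 i) \<and>
      breve star y = vec (2 * n2) (\<lambda>i. z $ emb2 n1 n2 i)"
    show "?w = z"
    proof (rule eq_vecI)
      fix i assume "i < dim_vec z"
      then have "i < 2 * (n1 + n2)" using z by auto
      then show "?w $ i = z $ i"
      proof (cases rule: emb_cases)
        case (1 p)
        then show ?thesis using * \<open>breve star x = vec (2 * n1) (\<lambda>i. ?w $ emb1 n1 n2 i)\<close>
          by (metis index_vec)
      next
        case (2 p)
        then show ?thesis using * \<open>breve star y = vec (2 * n2) (\<lambda>i. ?w $ emb2 n1 n2 i)\<close>
          by (metis index_vec)
      qed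
    qed (use x z in auto)
  qed
qed

lemma mat_act_block:
  assumes "M \<in> carrier_mat a k" "x \<in> carrier_vec k" "\<And>i. i < r \<Longrightarrow> f i < a"
  shows "vec r (\<lambda>i. mat_act scale M x $ f i) = mat_act scale (block f r id k M) x"
  using assms by (intro eq_vecI) (auto simp: mat_act_def block_def)

lemma mat_act_zero: "x \<in> carrier_vec k \<Longrightarrow> mat_act scale (0\<^sub>m r k) x = 0\<^sub>v r"
  by (intro eq_vecI) (auto simp: mat_act_def)

text \<open>Serves both for the complete input \<open>W b1 + V a\<close> and for the complete output
  of the closed loop.\<close>

lemma breve_append_eq_stack_iff:
  assumes "P \<in> carrier_mat (2 * n1) k" "Q \<in> carrier_mat (2 * n2) k" "x \<in> carrier_vec k"
    and "P' \<in> carrier_mat (2 * n1) l" "Q' \<in> carrier_mat (2 * n2) l" "y \<in> carrier_vec l"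
    and "u \<in> carrier_vec n1" "v \<in> carrier_vec n2"
  shows "breve star (u @\<^sub>v v) =
      mat_act scale (stack n1 n2 P Q) x + mat_act scale (stack n1 n2 P' Q') y \<longleftrightarrow>
    breve star u = mat_act scale P x + mat_act scale P' y \<and>
    breve star v = mat_act scale Q x + mat_act scale Q' y"
proof -
  let ?X = "stack n1 n2 P Q" and ?Y = "stack n1 n2 P' Q'"
  have X: "?X \<in> carrier_mat (2 * (n1 + n2)) k" and Y: "?Y \<in> carrier_mat (2 * (n1 + n2)) l"
    using assms by auto
  have split: "vec r (\<lambda>i. (mat_act scale ?X x + mat_act scale ?Y y) $ f i) =
      mat_act scale (block f r id k ?X) x + mat_act scale (block f r id l ?Y) y"
    if "\<And>i. i < r \<Longrightarrow> f i < 2 * (n1 + n2)" for r f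
    using that X Y assms(3,6) by (intro eq_vecI) (auto simp: mat_act_def block_def)
  have "mat_act scale ?X x + mat_act scale ?Y y \<in> carrier_vec (2 * (n1 + n2))"
    using X Y by (intro add_carrier_vec mat_act_carrier)
  from breve_append_eq_iff[OF assms(7,8) this] show ?thesis
    by (simp add: split block_stack[OF assms(1,2)] block_stack[OF assms(4,5)])
qed

end

section \<open>Eliminating the feedback loop\<close>

text \<open>Invertibility makes \<open>M\<close> a unit of the matrix ring, which excludes the value
  \<open>None\<close> of \<open>mat_inverse\<close>; so \<open>the\<close> yields a genuine
  two-sided inverse.\<close>

lemma mat_inv_inverse:
  assumes M: "M \<in> carrier_mat n n" and inv: "invertible_mat M"
  shows "mat_inv M \<in> carrier_mat n n" "M * mat_inv M = 1\<^sub>m n" "mat_inv M * M = 1\<^sub>m n"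
proof -
  from inv obtain B where B: "M * B = 1\<^sub>m n" "B * M = 1\<^sub>m (dim_row B)"
    using M by (auto simp: invertible_mat_def inverts_mat_def)
  \<comment> \<open>The size of \<open>B\<close> is not given by \<open>invertible_mat\<close>; it
    follows by comparing dimensions in the two identities.\<close>
  have "dim_col (M * B) = n" "dim_col (B * M) = dim_row B" using B by simp_all
  then have "B \<in> carrier_mat n n" using M by auto
  with B M have "M \<in> Units (ring_mat TYPE(complex) n ())"
    by (auto simp: Units_def ring_mat_def)
  then obtain R where "mat_inverse M = Some R"
    using mat_inverse(1)[OF M, of "()"] by (cases "mat_inverse M") auto
  with mat_inverse(2)[OF M this]
  show "mat_inv M \<in> carrier_mat n n" "M * mat_inv M = 1\<^sub>m n" "mat_inv M * M = 1\<^sub>m n"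
    by (auto simp: mat_inv_def)
qed

lemma mat_add_right_cancel:
  fixes A :: "'a::group_add mat"
  assumes "A \<in> carrier_mat r k" "B \<in> carrier_mat r k" "M \<in> carrier_mat r k" "A + M = B + M"
  shows "A = B"
proof (rule eq_matI)
  fix i j assume "i < dim_row B" "j < dim_col B"
  moreover have "(A + M) $$ (i, j) = (B + M) $$ (i, j)" using assms(4) by simp
  ultimately show "A $$ (i, j) = B $$ (i, j)" using assms(1-3) by auto
qed (use assms in auto)

lemma flat_one: "flat (1\<^sub>m (2 * n)) = 1\<^sub>m (2 * n)"
  by (intro eq_matI) (auto simp: flat_eq[of _ n n])

lemma flat_zero: "flat (0\<^sub>m (2 * n) (2 * m)) = 0\<^sub>m (2 * m) (2 * n)"
  by (intro eq_matI) (auto simp: flat_eq[of _ n m])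

text \<open>The factor \<open>flat S * S\<close> appears in the middle of the product and cancels:
  \<open>S\<close> is an isometry of the indefinite form.\<close>

lemma flat_unitary_gram:
  assumes S: "S \<in> carrier_mat (2 * n) (2 * n)" "flat S * S = 1\<^sub>m (2 * n)"
    and P: "P \<in> carrier_mat (2 * n) (2 * k)" and Q: "Q \<in> carrier_mat (2 * n) (2 * l)"
  shows "flat (S * P) * (S * Q) = flat P * Q"
proof -
  have "flat (S * P) * (S * Q) = flat P * (flat S * (S * Q))"
    unfolding flat_mult[OF S(1) P]
    by (rule assoc_mult_mat[OF flat_carrier[OF P] flat_carrier[OF S(1)] mult_carrier_mat[OF S(1) Q]])
  also have "flat S * (S * Q) = Q"
    using assoc_mult_mat[OF flat_carrier[OF S(1)] S(1) Q] S(2) Q by simp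
  finally show ?thesis .
qed

text \<open>The resolvent identity: \<open>R * Y\<close> solves the loop equation
  \<open>Z = K * Z + Y\<close>, since \<open>1 - K\<close> takes it back to
  \<open>Y\<close>.\<close>

lemma loop_fixed_point:
  fixes K :: "'a::comm_ring_1 mat"
  assumes K: "K \<in> carrier_mat n n" and R: "R \<in> carrier_mat n n" "(1\<^sub>m n - K) * R = 1\<^sub>m n"
    and Y: "Y \<in> carrier_mat n k"
  shows "K * (R * Y) + Y = R * Y"
proof -
  have RY: "R * Y \<in> carrier_mat n k" using R Y by simp
  have "Y = (1\<^sub>m n - K) * R * Y" using R Y by simp
  also have "\<dots> = (1\<^sub>m n - K) * (R * Y)"
    using K R Y by (intro assoc_mult_mat) (auto intro: minus_carrier_mat)
  also have "\<dots> = R * Y - K * (R * Y)"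
    using K RY by (subst minus_mult_distrib_mat[of _ n n]) auto
  finally have Y_eq: "Y = R * Y - K * (R * Y)" .
  have "K * (R * Y) + Y = K * (R * Y) + (R * Y - K * (R * Y))"
    using Y_eq by (rule arg_cong)
  also have "\<dots> = R * Y"
    using K RY by (intro eq_matI) auto
  finally show ?thesis .
qed

text \<open>On the fed-back channels input and output agree: \<open>W\<close> and
  \<open>S * W\<close> share the component \<open>T\<close>, while \<open>V\<close> and
  \<open>S * V + C\<close> share \<open>D\<close>. These channels therefore contribute equally
  before and after \<open>S\<close>, namely \<open>flat T * T\<close>, \<open>flat D * T\<close> and
  \<open>flat D * D\<close> in the three identities, and drop out.\<close>

lemma feedback_gram:
  assumes S: "S \<in> carrier_mat (2 * (n1 + n2)) (2 * (n1 + n2))" "flat S * S = 1\<^sub>m (2 * (n1 + n2))"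
    and C: "C \<in> carrier_mat (2 * (n1 + n2)) (2 * m)"
    and T: "T \<in> carrier_mat (2 * n2) (2 * n1)" and D: "D \<in> carrier_mat (2 * n2) (2 * m)"
    and S0: "S0 \<in> carrier_mat (2 * n1) (2 * n1)" and C0: "C0 \<in> carrier_mat (2 * n1) (2 * m)"
  defines "W \<equiv> stack n1 n2 (1\<^sub>m (2 * n1)) T" and "V \<equiv> stack n1 n2 (0\<^sub>m (2 * n1) (2 * m)) D"
  assumes SW: "S * W = stack n1 n2 S0 T" and SV: "S * V + C = stack n1 n2 C0 D"
  shows "flat S0 * S0 = 1\<^sub>m (2 * n1)"
    and "flat C0 * S0 = flat C * (S * W)"
    and "flat C0 * C0 = flat (flat C * (S * V)) + flat C * (S * V) + flat C * C"
proof -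
  have W: "W \<in> carrier_mat (2 * (n1 + n2)) (2 * n1)" and V: "V \<in> carrier_mat (2 * (n1 + n2)) (2 * m)"
    using D T by (simp_all add: W_def V_def)
  have SW': "S * W \<in> carrier_mat (2 * (n1 + n2)) (2 * n1)"
    and SV': "S * V \<in> carrier_mat (2 * (n1 + n2)) (2 * m)"
    using S W V by auto
  note fl = flat_carrier[OF C] flat_carrier[OF SV'] flat_carrier[OF T] flat_carrier[OF D]
    flat_carrier[OF S0] flat_carrier[OF C0]
  have one: "1\<^sub>m (2 * n1) \<in> carrier_mat (2 * n1) (2 * n1)" by simp
  have zero: "0\<^sub>m (2 * n1) (2 * m) \<in> carrier_mat (2 * n1) (2 * m)" by simp
  have "flat S0 * S0 + flat T * T = flat (S * W) * (S * W)"
    unfolding SW flat_stack_mult[OF S0 T S0 T] ..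
  also have "\<dots> = flat W * W" by (rule flat_unitary_gram[OF S W W])
  also have "\<dots> = 1\<^sub>m (2 * n1) + flat T * T"
    unfolding W_def flat_stack_mult[OF one T one T] by (simp add: flat_one)
  finally show "flat S0 * S0 = 1\<^sub>m (2 * n1)"
    by (rule mat_add_right_cancel[rotated 3]) (use S0 T fl in \<open>auto intro: mult_carrier_mat\<close>)
  have flat_SV: "flat (S * V + C) = flat (S * V) + flat C" by (rule flat_add[OF SV' C])
  have "flat C0 * S0 + flat D * T = flat (S * V + C) * (S * W)"
    unfolding SV SW flat_stack_mult[OF C0 D S0 T] ..
  also have "\<dots> = flat (S * V) * (S * W) + flat C * (S * W)"
    unfolding flat_SV by (rule add_mult_distrib_mat[OF fl(2) fl(1) SW'])
  also have "flat (S * V) * (S * W) = flat V * W" by (rule flat_unitary_gram[OF S V W])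
  \<comment> \<open>The first component of \<open>V\<close> vanishes, so only the fed-back channels
    contribute.\<close>
  also have "flat V * W = flat D * T"
    unfolding W_def V_def flat_stack_mult[OF zero D one T] using fl T by (simp add: flat_zero)
  also have "flat D * T + flat C * (S * W) = flat C * (S * W) + flat D * T"
    using fl T SW' by (intro comm_add_mat) auto
  finally show "flat C0 * S0 = flat C * (S * W)"
    by (rule mat_add_right_cancel[rotated 3]) (use S0 T SW' fl in \<open>auto intro: mult_carrier_mat\<close>)
  let ?X = "flat C * (S * V)"
  have flat_X: "flat ?X = flat (S * V) * C"
    using flat_mult[OF fl(1) SV'] flat_flat[OF C] by simp
  have "flat C0 * C0 + flat D * D = flat (S * V + C) * (S * V + C)"
    unfolding SV flat_stack_mult[OF C0 D C0 D] ..
  \<comment> \<open>The cross terms of this expansion are \<open>?X\<close> and its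
    \<open>flat\<close>; the leading square loses \<open>S\<close> by the isometry property.\<close>
  also have "\<dots> = (flat (S * V) * (S * V) + flat (S * V) * C) + (?X + flat C * C)"
    unfolding flat_SV
    by (subst add_mult_distrib_mat[OF fl(2) fl(1)])
      (use SV' C fl in \<open>auto simp: mult_add_distrib_mat[OF fl(2) SV' C] mult_add_distrib_mat[OF fl(1) SV' C]\<close>)
  also have "flat (S * V) * (S * V) = flat V * V" by (rule flat_unitary_gram[OF S V V])
  also have "flat V * V = flat D * D"
    unfolding V_def flat_stack_mult[OF zero D zero D] using mult_carrier_mat[OF fl(4) D] by (simp add: flat_zero)
  also have "flat (S * V) * C = flat ?X" using flat_X by simp
  also have "flat D * D + flat ?X + (?X + flat C * C) = flat ?X + ?X + flat C * C + flat D * D"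
    unfolding flat_X using C SV' D
    by (intro eq_matI) (auto simp: carrier_matD[OF fl(1)] carrier_matD[OF fl(2)] carrier_matD[OF fl(4)])
  finally show "flat C0 * C0 = flat ?X + ?X + flat C * C"
    unfolding flat_X
    by (rule mat_add_right_cancel[rotated 3]) (use C0 C D SV' fl in \<open>auto intro!: add_carrier_mat intro: mult_carrier_mat\<close>)
qed

text \<open>The last conjunct is an equivalence, so the elimination loses nothing: the loop signals
  are determined by \<open>b1\<close> and \<open>a\<close>, and every solution of the reduced
  equations extends to the loop.\<close>

theorem mainTheorem4:
  fixes n1 n2 m :: nat
    and S C Om Sm Sp Cm Cp :: "complex mat"
    and Sm11 Sm12 Sm21 Sm22 Sp11 Sp12 Sp21 Sp22 Cm1 Cm2 Cp1 Cp2 :: "complex mat"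
    and S11 S12 S21 S22 C1 C2 A R X S0 C0 Om0 :: "complex mat"
    and scale :: "complex \<Rightarrow> 'v::ab_group_add \<Rightarrow> 'v"
    and star :: "'v \<Rightarrow> 'v"
  assumes star_space: "star_vector_space scale star"
    and G: "(S, C, Om) \<in> Bog (n1 + n2) m"
    and S: "S = doubled Sm Sp" and C: "C = doubled Cm Cp"
    and Sm: "Sm = four_block_mat Sm11 Sm12 Sm21 Sm22"
    and Sp: "Sp = four_block_mat Sp11 Sp12 Sp21 Sp22"
    and Cm: "Cm = Cm1 @\<^sub>r Cm2" and Cp: "Cp = Cp1 @\<^sub>r Cp2"
    and Sm_dims: "Sm11 \<in> carrier_mat n1 n1" "Sm12 \<in> carrier_mat n1 n2"
                 "Sm21 \<in> carrier_mat n2 n1" "Sm22 \<in> carrier_mat n2 n2"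
    and Sp_dims: "Sp11 \<in> carrier_mat n1 n1" "Sp12 \<in> carrier_mat n1 n2"
                 "Sp21 \<in> carrier_mat n2 n1" "Sp22 \<in> carrier_mat n2 n2"
    and Cm_dims: "Cm1 \<in> carrier_mat n1 m" "Cm2 \<in> carrier_mat n2 m"
    and Cp_dims: "Cp1 \<in> carrier_mat n1 m" "Cp2 \<in> carrier_mat n2 m"
    and S11: "S11 = doubled Sm11 Sp11" and S12: "S12 = doubled Sm12 Sp12"
    and S21: "S21 = doubled Sm21 Sp21" and S22: "S22 = doubled Sm22 Sp22"
    and C1: "C1 = doubled Cm1 Cp1" and C2: "C2 = doubled Cm2 Cp2"
    and A: "A = (- 1 / 2) \<cdot>\<^sub>m (flat C * C) - \<i> \<cdot>\<^sub>m Om"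
    and inv: "invertible_mat (1\<^sub>m (2 * n2) - S22)"
    and R: "R = mat_inv (1\<^sub>m (2 * n2) - S22)"
    and X: "X = flat C1 * S12 * R * C2 + flat C2 * S22 * R * C2"
    and S0: "S0 = S11 + S12 * R * S21"
    and C0: "C0 = C1 + S12 * R * C2"
    and Om0: "Om0 = Om + Im_flat X"
  shows "S0 \<in> symp_group n1
       \<and> (S0, C0, Om0) \<in> Bog n1 m
       \<and> A - X = (- 1 / 2) \<cdot>\<^sub>m (flat C0 * C0) - \<i> \<cdot>\<^sub>m Om0
       \<and> (\<forall>adot \<in> carrier_vec m. \<forall>a \<in> carrier_vec m.
            \<forall>b1 \<in> carrier_vec n1. \<forall>bout1 \<in> carrier_vec n1.
            feedback_eqs scale star n2 (S, C, Om) adot a b1 bout1 \<longleftrightarrow>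
              breve star adot = mat_act scale (A - X) (breve star a)
                                  - mat_act scale (flat C0 * S0) (breve star b1) \<and>
              breve star bout1 = mat_act scale C0 (breve star a)
                                   + mat_act scale S0 (breve star b1))"
proof -

  \<comment> \<open>Sizes, blocks and doubled-up form of the given data\<close>
  interpret star_vector_space scale star by (rule star_space)
  have Sc: "S \<in> carrier_mat (2 * (n1 + n2)) (2 * (n1 + n2))"
    and S_unit: "flat S * S = 1\<^sub>m (2 * (n1 + n2))"
    and Cc: "C \<in> carrier_mat (2 * (n1 + n2)) (2 * m)"
    and Omc: "Om \<in> carrier_mat (2 * m) (2 * m)"
    and Om_doubled: "is_doubled m m ((- \<i>) \<cdot>\<^sub>m Om)" and flat_Om: "flat Om = Om"
    using G by (auto simp: Bog_def symp_group_def is_doubled_iff)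
  have doubledI: "is_doubled r k (doubled M N)" if "M \<in> carrier_mat r k" "N \<in> carrier_mat r k" 
    for r k M N
    using that by (auto simp: is_doubled_def)
  have dS: "is_doubled n1 n1 S11" "is_doubled n1 n2 S12" "is_doubled n2 n1 S21" "is_doubled n2 n2 S22"
    and dC: "is_doubled n1 m C1" "is_doubled n2 m C2"
    unfolding S11 S12 S21 S22 C1 C2 using Sm_dims Sp_dims Cm_dims Cp_dims by (auto intro: doubledI)
  then have S11c: "S11 \<in> carrier_mat (2 * n1) (2 * n1)" and S12c: "S12 \<in> carrier_mat (2 * n1) (2 * n2)"
    and S21c: "S21 \<in> carrier_mat (2 * n2) (2 * n1)" and S22c: "S22 \<in> carrier_mat (2 * n2) (2 * n2)"
    and C1c: "C1 \<in> carrier_mat (2 * n1) (2 * m)" and C2c: "C2 \<in> carrier_mat (2 * n2) (2 * m)"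
    by (auto simp: is_doubled_iff)
  have Z: "1\<^sub>m (2 * n2) - S22 \<in> carrier_mat (2 * n2) (2 * n2)" using S22c by (rule minus_carrier_mat)
  note R_inv = mat_inv_inverse[OF Z inv, folded R]
  note Rc = R_inv(1)
  have dR: "is_doubled n2 n2 R"
    using is_doubled_inverse[OF is_doubled_minus[OF is_doubled_one dS(4)] R_inv] .
  have S_blocks:
    "block (emb1 n1 n2) (2 * n1) (emb1 n1 n2) (2 * n1) S = S11"
    "block (emb1 n1 n2) (2 * n1) (emb2 n1 n2) (2 * n2) S = S12"
    "block (emb2 n1 n2) (2 * n2) (emb1 n1 n2) (2 * n1) S = S21"
    "block (emb2 n1 n2) (2 * n2) (emb2 n1 n2) (2 * n2) S = S22"
    unfolding S Sm Sp S11 S12 S21 S22 by (rule doubled_four_block[OF Sm_dims Sp_dims])+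
  have C_stack: "C = stack n1 n2 C1 C2"
    using Cc unfolding C Cm Cp C1 C2
    by (intro stack_eqI[where k = "2 * m"] doubled_append_rows[OF Cm_dims Cp_dims])

  \<comment> \<open>The solved loop and its Gram identities\<close>
  define T where "T = R * S21"
  define D where "D = R * C2"
  define W where "W = stack n1 n2 (1\<^sub>m (2 * n1)) T"
  define V where "V = stack n1 n2 (0\<^sub>m (2 * n1) (2 * m)) D"
  have Tc: "T \<in> carrier_mat (2 * n2) (2 * n1)" and Dc: "D \<in> carrier_mat (2 * n2) (2 * m)"
    using Rc S21c C2c by (auto simp: T_def D_def)
  have dT: "is_doubled n2 n1 T" and dD: "is_doubled n2 m D"
    unfolding T_def D_def by (rule is_doubled_mult[OF dR dS(3)], rule is_doubled_mult[OF dR dC(2)])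
  have Wc: "W \<in> carrier_mat (2 * (n1 + n2)) (2 * n1)" and Vc: "V \<in> carrier_mat (2 * (n1 + n2)) (2 * m)"
    by (simp_all add: W_def V_def)
  have S0_eq: "S0 = S11 + S12 * T" and C0_eq: "C0 = C1 + S12 * D"
    unfolding S0 C0 T_def D_def
    using assoc_mult_mat[OF S12c Rc S21c] assoc_mult_mat[OF S12c Rc C2c] by simp_all
  have dS0: "is_doubled n1 n1 S0" and dC0: "is_doubled n1 m C0"
    unfolding S0_eq C0_eq
    by (intro is_doubled_add is_doubled_mult[where m = n2] dS dC dT dD)+
  then have S0c: "S0 \<in> carrier_mat (2 * n1) (2 * n1)" and C0c: "C0 \<in> carrier_mat (2 * n1) (2 * m)"
    by (auto simp: is_doubled_iff)

  have T_fix: "S22 * T + S21 = T" and D_fix: "S22 * D + C2 = D"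
    unfolding T_def D_def
    by (rule loop_fixed_point[OF S22c R_inv(1,2) S21c], rule loop_fixed_point[OF S22c R_inv(1,2) C2c])
  have "S * W = stack n1 n2 (S11 * 1\<^sub>m (2 * n1) + S12 * T) (S21 * 1\<^sub>m (2 * n1) + S22 * T)"
    unfolding W_def using Tc by (subst mult_stack[OF Sc]) (auto simp: S_blocks)
  then have SW: "S * W = stack n1 n2 S0 T"
    using S11c S21c S22c Tc T_fix comm_add_mat[of S21 "2 * n2" "2 * n1" "S22 * T"]
    by (simp add: S0_eq)
  have "S * V = stack n1 n2 (S11 * 0\<^sub>m (2 * n1) (2 * m) + S12 * D) (S21 * 0\<^sub>m (2 * n1) (2 * m) + S22 * D)"
    unfolding V_def using Dc by (subst mult_stack[OF Sc]) (auto simp: S_blocks)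
  then have SV: "S * V = stack n1 n2 (S12 * D) (S22 * D)"
    using S11c S21c S12c S22c Dc by simp
  have SVC: "S * V + C = stack n1 n2 C0 D"
    unfolding SV C_stack using S12c S22c Dc C1c C2c D_fix comm_add_mat[of C1 "2 * n1" "2 * m" "S12 * D"]
    by (subst stack_add[where k = "2 * m"]) (auto simp: C0_eq)
  \<comment> \<open>As \<open>S * V\<close> stacks \<open>S12 * D\<close> and
    \<open>S22 * D\<close>, pairing it with \<open>C\<close> produces the two summands of
    \<open>X\<close>.\<close>
  have X_eq: "X = flat C * (S * V)"
  proof -
    have fl: "flat C1 \<in> carrier_mat (2 * m) (2 * n1)" "flat C2 \<in> carrier_mat (2 * m) (2 * n2)"
      using C1c C2c by auto
    have "M * K * R * C2 = M * (K * D)" if "M \<in> carrier_mat (2 * m) (2 * k)" "K \<in> carrier_mat (2 * k) (2 * n2)"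
      for M K k
      unfolding D_def using that Rc C2c
      by (simp add: assoc_mult_mat[of _ _ "2 * k" _ "2 * n2"] assoc_mult_mat[of _ _ "2 * n2" _ "2 * n2"])
    from this[OF fl(1) S12c] this[OF fl(2) S22c] show ?thesis
      unfolding X SV C_stack using C1c C2c S12c S22c Dc by (subst flat_stack_mult[of _ n1 m]) auto
  qed
  note gram = feedback_gram[OF Sc S_unit Cc Tc Dc S0c C0c, folded W_def V_def, OF SW SVC, folded X_eq]
  have dX: "is_doubled m m X"
    unfolding X by (intro is_doubled_add is_doubled_mult[where m = n2] is_doubled_mult[where m = n1 and k = n2]
        is_doubled_flat dS dC dR)
  then have Xc: "X \<in> carrier_mat (2 * m) (2 * m)" and fXc: "flat X \<in> carrier_mat (2 * m) (2 * m)"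
    by (auto simp: is_doubled_iff)
  have dXX: "is_doubled m m (X - flat X)" by (intro is_doubled_minus is_doubled_flat dX)
  then have XXc: "X - flat X \<in> carrier_mat (2 * m) (2 * m)" by (auto simp: is_doubled_iff)

  \<comment> \<open>Membership of the reduced triple in the class of systems\<close>
  have symp: "S0 \<in> symp_group n1"
    \<comment> \<open>The Gram identity gives a left inverse; for square matrices it is also a right
      inverse.\<close>
    using dS0 gram(1) mat_mult_left_right_inverse[OF flat_carrier[OF S0c] S0c gram(1)]
    by (simp add: symp_group_def)
  \<comment> \<open>The factors \<open>- \<i>\<close> and \<open>1 / (2 * \<i>)\<close> combine to
    the real number \<open>- 1 / 2\<close>, so doubled-up form survives.\<close>
  have "(- \<i>) \<cdot>\<^sub>m Om0 = (- \<i>) \<cdot>\<^sub>m Om + of_real (- 1 / 2) \<cdot>\<^sub>m (X - flat X)"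
    unfolding Om0 Im_flat_def using Omc Xc fXc by (intro eq_matI) (auto simp: field_simps)
  then have dOm0: "is_doubled m m ((- \<i>) \<cdot>\<^sub>m Om0)"
    using is_doubled_add[OF Om_doubled is_doubled_smult[OF dXX]] by metis
  \<comment> \<open>\<open>flat\<close> reverses the sign of \<open>X - flat X\<close> and, by
    conjugation, that of \<open>1 / (2 * \<i>)\<close>; the two signs cancel.\<close>
  have "flat (Im_flat X) = Im_flat X"
    unfolding Im_flat_def flat_smult[OF XXc] flat_minus[OF Xc fXc] flat_flat[OF Xc]
    using Xc fXc by (intro eq_matI) (auto simp: field_simps)
  moreover have Imc: "Im_flat X \<in> carrier_mat (2 * m) (2 * m)"
    unfolding Im_flat_def using XXc by simp
  ultimately have fOm0: "flat Om0 = Om0"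
    unfolding Om0 using flat_add[OF Omc Imc] flat_Om by simp
  have Om0c: "Om0 \<in> carrier_mat (2 * m) (2 * m)" unfolding Om0 using Omc Imc by simp
  have bog: "(S0, C0, Om0) \<in> Bog n1 m"
    using symp dC0 Om0c dOm0 fOm0 by (simp add: Bog_def)

  \<comment> \<open>The drift matrix of the reduced system\<close>
  have CCc: "flat C * C \<in> carrier_mat (2 * m) (2 * m)" using Cc by (auto intro: mult_carrier_mat)
  have Ac: "A \<in> carrier_mat (2 * m) (2 * m)" unfolding A using CCc Omc by (auto intro: minus_carrier_mat)
  have drift_eq: "A - X = (- 1 / 2) \<cdot>\<^sub>m (flat C0 * C0) - \<i> \<cdot>\<^sub>m Om0"
  proof -
    \<comment> \<open>Half of \<open>X + flat X\<close> comes from the coupling term and half of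
      \<open>X - flat X\<close> from \<open>Im_flat X\<close>; together they make up
      \<open>X\<close>. Here \<open>P\<close> stands for \<open>flat C * C\<close>.\<close>
    have "(- 1 / 2) \<cdot>\<^sub>m P - \<i> \<cdot>\<^sub>m Om - X = (- 1 / 2) \<cdot>\<^sub>m (flat X + X + P) - \<i> \<cdot>\<^sub>m Om0"
      if "P \<in> carrier_mat (2 * m) (2 * m)" for P
      unfolding Om0 Im_flat_def using that Omc Xc fXc
      by (intro eq_matI) (auto simp: field_simps)
    from this[OF CCc] show ?thesis unfolding A gram(3) .
  qed

  \<comment> \<open>Elimination of the loop signals from the equations\<close>
  have CSc: "flat C * S \<in> carrier_mat (2 * m) (2 * (n1 + n2))" using Cc Sc by (auto intro: mult_carrier_mat)
  have SVc: "S * V \<in> carrier_mat (2 * (n1 + n2)) (2 * m)" using Sc Vc by simp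
  have "feedback_eqs scale star n2 (S, C, Om) adot a b1 bout1 \<longleftrightarrow>
      breve star adot = mat_act scale (A - X) (breve star a) - mat_act scale (flat C0 * S0) (breve star b1) \<and>
      breve star bout1 = mat_act scale C0 (breve star a) + mat_act scale S0 (breve star b1)"
    (is "_ \<longleftrightarrow> ?rhs")
    if adot: "adot \<in> carrier_vec m" and a: "a \<in> carrier_vec m" and b1: "b1 \<in> carrier_vec n1"
      and bout1: "bout1 \<in> carrier_vec n1" for adot a b1 bout1
  proof -
    let ?a = "breve star a" and ?b1 = "breve star b1"
    have ac: "?a \<in> carrier_vec (2 * m)" and b1c: "?b1 \<in> carrier_vec (2 * n1)" using a b1 by auto
    let ?b2 = "mat_act scale T ?b1 + mat_act scale D ?a"
    \<comment> \<open>Once both loop signals take the value \<open>?b2\<close>, the full equations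
      are equivalent to the reduced ones; both directions of the claim rest on this.\<close>
    have system_iff: "system_eqs scale star (S, C, Om) adot a (b1 @\<^sub>v b2) (bout1 @\<^sub>v bout2) \<longleftrightarrow> ?rhs"
      if b2: "b2 \<in> carrier_vec n2" "breve star b2 = ?b2" and bout2: "bout2 \<in> carrier_vec n2" "breve star bout2 = ?b2"
      for b2 bout2
    proof -
      let ?u = "breve star (b1 @\<^sub>v b2)"
      have "?u = mat_act scale W ?b1 + mat_act scale V ?a"
        unfolding W_def V_def
        by (subst breve_append_eq_stack_iff[OF one_carrier_mat Tc b1c zero_carrier_mat Dc ac b1 b2(1)])
          (use b1c ac b2 in \<open>simp add: mat_act_one mat_act_zero\<close>)
      then have act: "mat_act scale M ?u = mat_act scale (M * W) ?b1 + mat_act scale (M * V) ?a"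
        if "M \<in> carrier_mat r (2 * (n1 + n2))" for M r
        using that Wc Vc b1c ac
        by (simp add: mat_act_mult mat_act_add_vec[where k = "2 * (n1 + n2)"])
      have "mat_act scale C ?a + mat_act scale S ?u
          = mat_act scale (S * W) ?b1 + mat_act scale (S * V + C) ?a"
        unfolding act[OF Sc] mat_act_add[OF SVc Cc ac] using Sc Cc
        by (intro eq_vecI) (auto simp: mat_act_def add_ac)
      moreover have comm: "mat_act scale C0 ?a + mat_act scale S0 ?b1 = mat_act scale S0 ?b1 + mat_act scale C0 ?a"
        by (rule comm_add_vec[OF mat_act_carrier[OF C0c] mat_act_carrier[OF S0c]])
      \<comment> \<open>The fed-back component of the output equation reads
        \<open>breve star bout2 = ?b2\<close>, which is given, so only the first component
        remains.\<close>
      ultimately have out: "breve star (bout1 @\<^sub>v bout2) = mat_act scale C ?a + mat_act scale S ?u \<longleftrightarrow>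
          breve star bout1 = mat_act scale C0 ?a + mat_act scale S0 ?b1"
        unfolding SW SVC comm
        using breve_append_eq_stack_iff[OF S0c Tc b1c C0c Dc ac bout1 bout2(1)] bout2(2) by simp
      have CSW: "flat C * S * W = flat C0 * S0" and CSV: "flat C * S * V = X"
        unfolding gram(2) X_eq
        using assoc_mult_mat[OF flat_carrier[OF Cc] Sc Wc] assoc_mult_mat[OF flat_carrier[OF Cc] Sc Vc]
        by simp_all
      \<comment> \<open>The input \<open>W b1 + V a\<close> contributes \<open>flat C0 * S0\<close>
        on \<open>b1\<close> and \<open>X\<close> on \<open>a\<close>; the latter is absorbed into
        the drift.\<close>
      have "mat_act scale A ?a - mat_act scale (flat C * S) ?u
          = mat_act scale (A - X) ?a - mat_act scale (flat C0 * S0) ?b1"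
        unfolding act[OF CSc] CSW CSV mat_act_minus[OF Ac Xc ac] using Ac Xc C0c
        by (intro eq_vecI) (auto simp: mat_act_def algebra_simps flat_eq)
      then show ?thesis using out by (simp add: A)
    qed
    show ?thesis
    proof
      assume "feedback_eqs scale star n2 (S, C, Om) adot a b1 bout1"
      then obtain b2 bout2 where b2: "b2 \<in> carrier_vec n2" and bout2: "bout2 \<in> carrier_vec n2"
        and loop: "breve star b2 = breve star bout2"
        and sys: "system_eqs scale star (S, C, Om) adot a (b1 @\<^sub>v b2) (bout1 @\<^sub>v bout2)"
        by (auto simp: feedback_eqs_def)
      let ?u = "breve star (b1 @\<^sub>v b2)"
      let ?y = "mat_act scale C ?a + mat_act scale S ?u"
      have b2c: "breve star b2 \<in> carrier_vec (2 * n2)" using b2 by simp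
      have y: "?y \<in> carrier_vec (2 * (n1 + n2))" using Cc Sc by simp
      \<comment> \<open>The fed-back rows of the output equation, with \<open>bout2\<close>
        identified with \<open>b2\<close>, become \<open>(1 - S22) b2 = S21 b1 + C2 a\<close>;
        applying \<open>R\<close> then yields \<open>?b2\<close>.\<close>
      have "breve star bout2 = vec (2 * n2) (\<lambda>i. ?y $ emb2 n1 n2 i)"
        using sys breve_append_eq_iff[OF bout1 bout2 y] by simp
      also have "\<dots> = vec (2 * n2) (\<lambda>i. mat_act scale C ?a $ emb2 n1 n2 i) +
          vec (2 * n2) (\<lambda>i. mat_act scale S ?u $ emb2 n1 n2 i)"
        using Cc Sc by (intro eq_vecI) (auto simp: mat_act_def)
      also have "\<dots> = mat_act scale C2 ?a +
          (mat_act scale S21 ?b1 + mat_act scale S22 (breve star b2))"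
        using mat_act_block[OF Cc ac, of "2 * n2" "emb2 n1 n2"] block_stack(2)[OF C1c C2c]
          mat_act_append[OF Sc b1 b2, of "2 * n2" "emb2 n1 n2"]
        by (simp add: S_blocks flip: C_stack)
      finally have "mat_act scale (1\<^sub>m (2 * n2) - S22) (breve star b2)
          = mat_act scale C2 ?a + (mat_act scale S21 ?b1 + mat_act scale S22 (breve star b2))
              - mat_act scale S22 (breve star b2)"
        unfolding mat_act_minus[OF one_carrier_mat S22c b2c] mat_act_one[OF b2c] using loop by simp
      also have "\<dots> = mat_act scale S21 ?b1 + mat_act scale C2 ?a"
        using S21c S22c C2c by (intro eq_vecI) (auto simp: mat_act_def)
      finally have "mat_act scale R (mat_act scale (1\<^sub>m (2 * n2) - S22) (breve star b2))
          = mat_act scale R (mat_act scale S21 ?b1 + mat_act scale C2 ?a)" by simp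
      then have "breve star b2 = ?b2"
        unfolding mat_act_mult[OF Rc Z b2c, symmetric] R_inv(3) mat_act_one[OF b2c]
          mat_act_add_vec[OF Rc mat_act_carrier[OF S21c] mat_act_carrier[OF C2c]]
          mat_act_mult[OF Rc S21c b1c, symmetric] mat_act_mult[OF Rc C2c ac, symmetric]
          T_def D_def .
      then show ?rhs using system_iff[of b2 bout2] b2 bout2 loop sys by simp
    next
      assume rhs: ?rhs
      \<comment> \<open>As \<open>T\<close> and \<open>D\<close> are doubled-up, \<open>?b2\<close>
        is the doubled-up vector of \<open>y1 + y2\<close>, which serves as both \<open>b2\<close>
        and \<open>bout2\<close>.\<close>
      obtain y1 y2 where "y1 \<in> carrier_vec n2" "y2 \<in> carrier_vec n2"
        and "mat_act scale T ?b1 = breve star y1" "mat_act scale D ?a = breve star y2"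
        using mat_act_breve[OF dT b1] mat_act_breve[OF dD a] by blast
      then have b2: "y1 + y2 \<in> carrier_vec n2" "breve star (y1 + y2) = ?b2"
        by (auto simp: breve_add)
      show "feedback_eqs scale star n2 (S, C, Om) adot a b1 bout1"
        unfolding feedback_eqs_def using b2 rhs system_iff[OF b2 b2] by blast
    qed
  qed
  with symp bog drift_eq show ?thesis by blast
qed

end
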